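(* Let $G$ be a finite abelian group and $E\subseteq G$ with $|E|=n>1$. Then $$L(E)>\frac{1}{e\,n^{n-1}},\qquad U(E)<n^2-\frac{n-1}{4},\qquad \rho(E)<4n^n,\qquad D(E)\ge 1.$$
   Context: $\widehat G$ is the group of characters $G\to\mathbb{S}^1$. For nonempty $E=\{x_1,\dots,x_n\}\subseteq G$ and $B=\{b_1,\dots,b_n\}\subseteq\widehat G$, $T(E,B)$ is the $n\times n$ matrix with $(i,j)$ entry $b_j(x_i)$. Define $L_E(B)=\sigma_{\min}(T(E,B))^2$ (equal to $\|T^{-1}\|^{-2}$ if $T$ is invertible and $0$ otherwise), $U_E(B)=\|T(E,B)\|^2$ (operator $2$-norm), $\rho_E(B)=U_E(B)/L_E(B)$ ($\infty$ if $L_E(B)=0$), $D_E(B)=|\det T(E,B)|$. Then $L(E)=\max_B L_E(B)$, $U(E)=\min_B U_E(B)$, $\rho(E)=\min_B\rho_E(B)$, $D(E)=\max_B D_E(B)$, where $B$ ranges over subsets of $\widehat G$ with $|B|=|E|$. $e$ is Euler's number. *)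

theory Defs
  imports
    "HOL-Algebra.Group"
    "HOL-Library.Extended_Real"
    "Jordan_Normal_Form.Schur_Decomposition"
begin

definition circle_group :: "complex monoid" where
  "circle_group = \<lparr>carrier = {z. cmod z = 1}, monoid.mult = (*), one = 1\<rparr>"

text \<open>Restricting to extensional functions makes a character determined by its values on the
  carrier, so that cardinalities of sets of characters have their intended meaning.\<close>

definition characters :: "('a, 'm) monoid_scheme \<Rightarrow> ('a \<Rightarrow> complex) set" where
  "characters G = hom G circle_group \<inter> extensional (carrier G)"

definition vec_norm2 :: "complex vec \<Rightarrow> real" where
  "vec_norm2 v = sqrt (\<Sum>i<dim_vec v. (cmod (v $ i))\<^sup>2)"

definition op_norm2 :: "complex mat \<Rightarrow> real" where
  "op_norm2 A = (SUP v\<in>{v \<in> carrier_vec (dim_col A). vec_norm2 v \<le> 1}. vec_norm2 (A *\<^sub>v v))"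

definition singular_values :: "complex mat \<Rightarrow> real set" where
  "singular_values A =
     {s. 0 \<le> s \<and> eigenvalue (mat_adjoint A * A) (complex_of_real (s\<^sup>2))}"

definition sigma_min :: "complex mat \<Rightarrow> real" where
  "sigma_min A = Min (singular_values A)"

text \<open>An arbitrary enumeration of a finite set. The quantities derived below from the matrix
  \<open>T E B\<close> (singular values, operator norm, modulus of the determinant) are invariant under
  permutations of rows and columns, so they do not depend on the enumerations chosen.\<close>

definition enum_list :: "'a set \<Rightarrow> 'a list" where
  "enum_list A = (SOME xs. distinct xs \<and> set xs = A)"

definition T :: "'a set \<Rightarrow> ('a \<Rightarrow> complex) set \<Rightarrow> complex mat" where
  "T E B = mat (card E) (card B) (\<lambda>(i, j). (enum_list B ! j) (enum_list E ! i))"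

definition L_at :: "'a set \<Rightarrow> ('a \<Rightarrow> complex) set \<Rightarrow> real" where
  "L_at E B = (sigma_min (T E B))\<^sup>2"

definition U_at :: "'a set \<Rightarrow> ('a \<Rightarrow> complex) set \<Rightarrow> real" where
  "U_at E B = (op_norm2 (T E B))\<^sup>2"

definition rho_at :: "'a set \<Rightarrow> ('a \<Rightarrow> complex) set \<Rightarrow> ereal" where
  "rho_at E B = (if L_at E B = 0 then \<infinity> else ereal (U_at E B / L_at E B))"

definition D_at :: "'a set \<Rightarrow> ('a \<Rightarrow> complex) set \<Rightarrow> real" where
  "D_at E B = cmod (det (T E B))"

definition char_subsets :: "('a, 'm) monoid_scheme \<Rightarrow> 'a set \<Rightarrow> ('a \<Rightarrow> complex) set set" where
  "char_subsets G E = {B. B \<subseteq> characters G \<and> card B = card E}"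

text \<open>For a finite abelian group \<open>G\<close> and nonempty \<open>E \<subseteq> carrier G\<close> the index set
  \<open>char_subsets G E\<close> is finite and nonempty, so the following extrema are attained.\<close>

definition L_opt :: "('a, 'm) monoid_scheme \<Rightarrow> 'a set \<Rightarrow> real" where
  "L_opt G E = Max (L_at E ` char_subsets G E)"

definition U_opt :: "('a, 'm) monoid_scheme \<Rightarrow> 'a set \<Rightarrow> real" where
  "U_opt G E = Min (U_at E ` char_subsets G E)"

definition rho_opt :: "('a, 'm) monoid_scheme \<Rightarrow> 'a set \<Rightarrow> ereal" where
  "rho_opt G E = Min (rho_at E ` char_subsets G E)"

definition D_opt :: "('a, 'm) monoid_scheme \<Rightarrow> 'a set \<Rightarrow> real" where
  "D_opt G E = Max (D_at E ` char_subsets G E)"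

end

theory Submission
  imports Defs "HOL-Algebra.Multiplicative_Group" "HOL-Analysis.L2_Norm"
begin

text \<open>The rows of the full character table are orthogonal, so the mean of \<open>\<bar>det\<bar>\<^sup>2\<close> over all
  \<open>n\<close>-tuples of characters is \<open>n!\<close>; hence some \<open>B\<close> has \<open>\<bar>det (T E B)\<bar> \<ge> 1\<close>. For this \<open>B\<close> the
  squared singular values are positive with sum \<open>n\<^sup>2\<close> (all entries are unimodular) and product at
  least \<open>1\<close>, and all three remaining bounds follow from the inequality of arithmetic and
  geometric means. The squared operator norm is itself one of these eigenvalues, so the spectral
  theorem is not needed.\<close>

section \<open>Characters of finite abelian groups\<close>

text \<open>The mean runs over tuples with repetitions, which have equal rows and determinant 0; a
  tuple reaching modulus 1 is therefore automatically a set of \<open>n\<close> distinct characters.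
  Orthogonality of the rows needs, for each \<open>g\<close> other than the identity, a character
  with value different from 1 at \<open>g\<close>; this is where the structure of the group enters,
  through extension of characters from subgroups.

  Each optimum is a maximum to be bounded below or a minimum to be bounded above, so a single
  \<open>B\<close> settles all four. The eigenvalues must be counted with multiplicity for trace and
  determinant to become their sum and product, whereas \<open>sigma_min\<close> and
  \<open>op_norm2\<close> are defined through a set and a supremum; for the link it is enough that
  their squares occur somewhere in the list, because the numerical bounds hold for every member and
  every pair of members.\<close>

text \<open>Here \<open>c\<close> is a total function with arbitrary values outside
  \<open>H\<close>. This makes extending it from \<open>H\<close> to a larger subgroup a matter of
  agreement on \<open>H\<close>; the restriction to the carrier is made once, at the end.\<close>

definition char_on :: "('a, 'm) monoid_scheme \<Rightarrow> 'a set \<Rightarrow> ('a \<Rightarrow> complex) \<Rightarrow> bool" where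
  "char_on G H c \<longleftrightarrow> subgroup H G \<and> (\<forall>x\<in>H. cmod (c x) = 1) \<and>
     (\<forall>x\<in>H. \<forall>y\<in>H. c (x \<otimes>\<^bsub>G\<^esub> y) = c x * c y)"

lemma (in group) char_on_one:
  assumes "char_on G H c" shows "c \<one> = 1"
proof -
  have "\<one> \<in> H" using assms by (auto simp: char_on_def subgroup.one_closed)
  then have "c (\<one> \<otimes> \<one>) = c \<one> * c \<one>" "cmod (c \<one>) = 1" using assms unfolding char_on_def by blast+
  then show ?thesis by auto
qed

lemma (in group) char_on_pow:
  assumes "char_on G H c" "x \<in> H" shows "c (x [^] (k::nat)) = c x ^ k"
proof (induction k)
  case 0
  then show ?case using char_on_one[OF assms(1)] by simp
next
  case (Suc k)
  have "subgroup H G" using assms by (auto simp: char_on_def)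
  then interpret H: subgroup H G .
  have "x [^] k \<in> H" using assms(2) by (induction k) auto
  then show ?case using assms Suc by (simp add: char_on_def)
qed

lemma exists_complex_root:
  assumes "k > 0" obtains z :: complex where "z ^ k = w"
proof (cases "w = 0")
  case True
  then show ?thesis using assms that[of 0] by simp
next
  case False
  have "rcis (root k (cmod w)) (Arg w / real k) ^ k = rcis (cmod w) (Arg w)"
    using assms by (simp add: DeMoivre2)
  then show ?thesis using that by (simp add: rcis_cmod_Arg)
qed

text \<open>Division with remainder: the remainder \<open>m mod k\<close> is again an exponent that
  sends \<open>a\<close> into \<open>H\<close>, and it is smaller than \<open>k\<close>, so
  minimality forces it to be 0.\<close>

lemma (in group) least_pow_dvd:
  assumes H: "subgroup H G" and a: "a \<in> carrier G" and k: "k > 0" "a [^] k \<in> H"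
    and least: "\<And>j. 0 < j \<Longrightarrow> a [^] (j::nat) \<in> H \<Longrightarrow> k \<le> j"
    and m: "a [^] (m::nat) \<in> H"
  shows "k dvd m"
proof (rule ccontr)
  assume nd: "\<not> k dvd m"
  interpret H: subgroup H G by fact
  have q: "(a [^] k) [^] q \<in> H" for q :: nat
    using k(2) by (induction q) auto
  have "a [^] m = (a [^] k) [^] (m div k) \<otimes> a [^] (m mod k)"
    using a by (simp add: nat_pow_pow nat_pow_mult)
  then have "a [^] (m mod k) = inv ((a [^] k) [^] (m div k)) \<otimes> a [^] m"
    using a by (simp add: m_assoc[symmetric])
  then have "a [^] (m mod k) \<in> H" using q m by simp
  then show False using least[of "m mod k"] nd k(1)
    by (metis dvd_eq_mod_eq_0 gr0I mod_less_divisor not_le)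
qed

text \<open>Every relation between \<open>a\<close> and \<open>H\<close> comes from
  \<open>a [^] k \<in> H\<close>, so \<open>z ^ k = c (a [^] k)\<close> is the only condition on the
  new value. The choice of \<open>z\<close> is left to the caller, who may want a root other than
  1.\<close>

lemma (in comm_group) char_on_adjoin:
  assumes fin: "finite (carrier G)" and c: "char_on G H c" and a: "a \<in> carrier G"
    and k: "k > 0" "a [^] k \<in> H"
    and least: "\<And>j. 0 < j \<Longrightarrow> a [^] (j::nat) \<in> H \<Longrightarrow> k \<le> j"
    and z: "z ^ k = c (a [^] k)"
  obtains H' c' where "char_on G H' c'" "H \<subseteq> H'" "a \<in> H'" "\<And>x. x \<in> H \<Longrightarrow> c' x = c x" "c' a = z"
proof -
  have sub: "subgroup H G" using c by (simp add: char_on_def)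
  interpret H: subgroup H G by fact
  \<comment> \<open>The subgroup generated by \<open>H\<close> and \<open>a\<close>; natural
    exponents are enough because \<open>a\<close> has finite order.\<close>
  define H' where "H' = {h \<otimes> a [^] (j::nat) | h j. h \<in> H}"
  define c' where "c' = (\<lambda>x. SOME w. \<exists>h j. h \<in> H \<and> x = h \<otimes> a [^] (j::nat) \<and> w = c h * z ^ j)"
  have mulc: "c (x \<otimes> y) = c x * c y" if "x \<in> H" "y \<in> H" for x y
    using c that by (simp add: char_on_def)
  \<comment> \<open>Independence of the representation: cancelling \<open>a [^] j\<close> leaves
    \<open>a [^] (i - j) \<in> H\<close>, whose exponent is a multiple of \<open>k\<close>, and
    there \<open>c\<close> already agrees with powers of \<open>z\<close>.\<close>
  have wd: "c h * z ^ i = c g * z ^ j"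
    if "h \<in> H" "g \<in> H" "h \<otimes> a [^] i = g \<otimes> a [^] j" "j \<le> i" for h g and i j :: nat
  proof -
    have "h \<otimes> a [^] (i - j) \<otimes> a [^] j = g \<otimes> a [^] j"
      using that a by (simp add: m_assoc nat_pow_mult)
    then have e: "h \<otimes> a [^] (i - j) = g"
      using that a by (metis H.mem_carrier m_closed nat_pow_closed right_cancel)
    then have "a [^] (i - j) = inv h \<otimes> g"
      using that a by (metis H.mem_carrier inv_solve_left nat_pow_closed)
    then have mem: "a [^] (i - j) \<in> H" using that by simp
    then have "k dvd i - j" using least_pow_dvd[OF sub a k least] by blast
    then obtain q where q: "i - j = k * q" by blast
    then have "c (a [^] (i - j)) = z ^ (i - j)"
      using char_on_pow[OF c k(2), of q] a by (simp add: nat_pow_pow z power_mult)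
    then have "c g = c h * z ^ (i - j)" using mulc[OF that(1) mem] e by simp
    then show ?thesis using that(4) by (simp add: mult.assoc flip: power_add)
  qed
  have c'_eq: "c' (h \<otimes> a [^] j) = c h * z ^ j" if "h \<in> H" for h and j :: nat
  proof -
    have "\<exists>g i. g \<in> H \<and> h \<otimes> a [^] j = g \<otimes> a [^] (i::nat) \<and> c' (h \<otimes> a [^] j) = c g * z ^ i"
      unfolding c'_def by (rule someI_ex) (use that in blast)
    then obtain g and i :: nat where "g \<in> H" "h \<otimes> a [^] j = g \<otimes> a [^] i"
      "c' (h \<otimes> a [^] j) = c g * z ^ i" by blast
    then show ?thesis using wd[of h g j i] wd[of g h i j] that by (metis nat_le_linear)
  qed
  have mulH': "(h \<otimes> a [^] i) \<otimes> (g \<otimes> a [^] j) = (h \<otimes> g) \<otimes> a [^] (i + j)"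
    if "h \<in> H" "g \<in> H" for h g and i j :: nat
    using that a by (simp add: nat_pow_mult[symmetric] m_ac)
  have "cmod z ^ k = 1" using c k z by (metis char_on_def norm_power)
  then have nz: "cmod z = 1" using k(1) by (metis norm_ge_zero power_eq_1_iff abs_norm_cancel gr_implies_not0 real_norm_def)
  have H'_cl: "x \<otimes> y \<in> H'" if "x \<in> H'" "y \<in> H'" for x y
    using that mulH' by (fastforce simp: H'_def)
  have H'_car: "H' \<subseteq> carrier G" using a by (auto simp: H'_def)
  have HH': "h \<in> H'" if "h \<in> H" for h
    using that by (auto simp: H'_def intro!: exI[of _ h] exI[of _ "0::nat"])
  have aH': "a \<in> H'"
    using a by (auto simp: H'_def intro!: exI[of _ \<one>] exI[of _ "1::nat"])
  have "subgroup H' G"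
  proof (rule subgroupI)
    show "H' \<subseteq> carrier G" "H' \<noteq> {}" using H'_car aH' by auto
    fix x assume x: "x \<in> H'"
    have pw: "x [^] m \<in> H'" for m :: nat
      using x H'_cl HH'[OF H.one_closed] by (induction m) auto
    have xc: "x \<in> carrier G" using x H'_car by auto
    \<comment> \<open>In a finite group the inverse is a power, so closure under products already
      gives closure under inverses.\<close>
    have "Coset.order G > 0" using fin by (simp add: order_gt_0_iff_finite)
    then have "x [^] (Coset.order G - 1) \<otimes> x = \<one>"
      using pow_order_eq_1[OF xc] by (metis Suc_diff_1 nat_pow_Suc)
    then have "inv x = x [^] (Coset.order G - 1)" using xc by (metis inv_equality nat_pow_closed)
    then show "inv x \<in> H'" using pw by simp
  qed (rule H'_cl)
  moreover have "c' (x \<otimes> y) = c' x * c' y" if "x \<in> H'" "y \<in> H'" for x y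
    using that by (auto simp: H'_def mulH' c'_eq mulc power_add)
  moreover have "cmod (c' x) = 1" if "x \<in> H'" for x
    using that c nz by (auto simp: H'_def c'_eq norm_mult norm_power char_on_def)
  ultimately have "char_on G H' c'" by (auto simp: char_on_def)
  moreover have "c' x = c x" if "x \<in> H" for x using c'_eq[OF that, of 0] that by simp
  moreover have "c' a = z"
    using c'_eq[OF H.one_closed, of 1] a char_on_one[OF c] by simp
  ultimately show ?thesis using that HH' aH' by blast
qed

lemma (in comm_group) least_pow_exists:
  assumes "finite (carrier G)" "subgroup H G" "a \<in> carrier G"
  obtains k :: nat where "k > 0" "a [^] k \<in> H" "\<And>j. 0 < j \<Longrightarrow> a [^] (j::nat) \<in> H \<Longrightarrow> k \<le> j"
proof -
  let ?P = "\<lambda>k::nat. k > 0 \<and> a [^] k \<in> H"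
  have "?P (Coset.order G)"
    using assms pow_order_eq_1 by (simp add: order_gt_0_iff_finite subgroup.one_closed)
  then have "?P (Least ?P)" by (rule LeastI)
  then show ?thesis using that[of "Least ?P"] by (auto intro: Least_le)
qed

text \<open>Roots of every positive order exist among the complex numbers, so one more element can
  always be adjoined; the number of elements still missing decreases.\<close>

lemma (in comm_group) char_on_extend:
  assumes fin: "finite (carrier G)" and "char_on G H c"
  shows "\<exists>c'. char_on G (carrier G) c' \<and> (\<forall>x\<in>H. c' x = c x)"
  using assms(2)
proof (induction "card (carrier G - H)" arbitrary: H c rule: less_induct)
  case less
  have sub: "subgroup H G" using less.prems by (simp add: char_on_def)
  then have Hc: "H \<subseteq> carrier G" by (rule subgroup.subset)
  show ?case
  proof (cases "H = carrier G")
    case True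
    then show ?thesis using less.prems by blast
  next
    case False
    then obtain a where a: "a \<in> carrier G" "a \<notin> H" using Hc by blast
    obtain k :: nat where k: "k > 0" "a [^] k \<in> H" "\<And>j. 0 < j \<Longrightarrow> a [^] (j::nat) \<in> H \<Longrightarrow> k \<le> j"
      using least_pow_exists[OF fin sub a(1)] by blast
    obtain z where "z ^ k = c (a [^] k)" using exists_complex_root[OF k(1)] by blast
    then obtain H' c' where c': "char_on G H' c'" "H \<subseteq> H'" "a \<in> H'" "\<And>x. x \<in> H \<Longrightarrow> c' x = c x"
      using char_on_adjoin[OF fin less.prems a(1) k] by metis
    have "card (carrier G - H') < card (carrier G - H)"
      using fin a c' by (intro psubset_card_mono) auto
    from less.hyps[OF this c'(1)] show ?thesis using c' by fastforce
  qed
qed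

lemma (in comm_group) char_on_carrier_imp_characters:
  assumes "char_on G (carrier G) c"
  shows "restrict c (carrier G) \<in> characters G"
  using assms by (auto simp: characters_def circle_group_def hom_def char_on_def)

text \<open>Over the trivial subgroup the least exponent \<open>k\<close> is the order of
  \<open>g\<close>. It exceeds 1, so there is a \<open>k\<close>-th root of unity other than 1 to
  serve as the value at \<open>g\<close>, and the result extends to the whole group.\<close>

lemma (in comm_group) characters_separate_points:
  assumes fin: "finite (carrier G)" and g: "g \<in> carrier G" "g \<noteq> \<one>"
  obtains c where "c \<in> characters G" "c g \<noteq> 1"
proof -
  have triv: "char_on G {\<one>} (\<lambda>_. 1)" using triv_subgroup by (auto simp: char_on_def)
  obtain k :: nat where k: "k > 0" "g [^] k \<in> {\<one>}" "\<And>j. 0 < j \<Longrightarrow> g [^] (j::nat) \<in> {\<one>} \<Longrightarrow> k \<le> j"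
    using least_pow_exists[OF fin triv_subgroup g(1)] by blast
  have "k \<noteq> 1" using k(2) g by auto
  then have "k > 1" using k(1) by simp
  have "card {z::complex. z ^ k = 1} = k" using \<open>k > 1\<close> by (intro card_roots_unity_eq) simp
  then have "\<not> {z::complex. z ^ k = 1} \<subseteq> {1}"
    using \<open>k > 1\<close> card_mono[of "{1::complex}" "{z. z ^ k = 1}"] by auto
  then obtain z :: complex where "z ^ k = 1" "z \<noteq> 1" by blast
  then obtain H c where c: "char_on G H c" "g \<in> H" "c g \<noteq> 1"
    using char_on_adjoin[OF fin triv g(1) k, of z] by metis
  then obtain c' where c': "char_on G (carrier G) c'" "c' g = c g"
    using char_on_extend[OF fin c(1)] by blast
  then show ?thesis using that[OF char_on_carrier_imp_characters[OF c'(1)]] c(3) g by simp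
qed

section \<open>Finiteness and orthogonality of characters\<close>

lemma characters_mult:
  assumes "c \<in> characters G" "x \<in> carrier G" "y \<in> carrier G"
  shows "c (x \<otimes>\<^bsub>G\<^esub> y) = c x * c y"
  using assms by (auto simp: characters_def circle_group_def hom_def)

lemma characters_norm:
  assumes "c \<in> characters G" "x \<in> carrier G" shows "cmod (c x) = 1"
  using assms by (auto simp: characters_def circle_group_def hom_def)

lemma (in comm_group) characters_char_on:
  "c \<in> characters G \<Longrightarrow> char_on G (carrier G) c"
  by (auto simp: char_on_def characters_mult characters_norm subgroup_self)

text \<open>By Lagrange all values are roots of unity of order \<open>Coset.order G\<close>, and
  extensionality leaves only finitely many functions with such values.\<close>

lemma (in comm_group) finite_characters:
  assumes fin: "finite (carrier G)" shows "finite (characters G)"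
proof (rule finite_subset)
  let ?R = "{z::complex. z ^ Coset.order G = 1}"
  have "Coset.order G > 0" using fin by (simp add: order_gt_0_iff_finite)
  then have "finite ?R" by (intro finite_roots_unity) simp
  then show "finite (carrier G \<rightarrow>\<^sub>E ?R)" using fin by (rule_tac finite_PiE) auto
  show "characters G \<subseteq> carrier G \<rightarrow>\<^sub>E ?R"
  proof
    fix c assume c: "c \<in> characters G"
    have "c x ^ Coset.order G = 1" if "x \<in> carrier G" for x
      using char_on_pow[OF characters_char_on[OF c] that, of "Coset.order G"] pow_order_eq_1[OF that]
        char_on_one[OF characters_char_on[OF c]] by simp
    then show "c \<in> carrier G \<rightarrow>\<^sub>E ?R" using c by (auto simp: characters_def PiE_def)
  qed
qed

lemma (in comm_group) characters_nonempty: "characters G \<noteq> {}"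
proof -
  have "char_on G (carrier G) (\<lambda>_. 1)" by (auto simp: char_on_def subgroup_self)
  then show ?thesis using char_on_carrier_imp_characters by blast
qed

text \<open>Multiplication by a character \<open>d\<close> with \<open>d g \<noteq> 1\<close>
  permutes the characters, so the sum equals \<open>d g\<close> times itself.\<close>

lemma (in comm_group) sum_characters_eq_0:
  assumes fin: "finite (carrier G)" and g: "g \<in> carrier G" "g \<noteq> \<one>"
  shows "(\<Sum>c\<in>characters G. c g) = 0"
proof -
  obtain d where d: "d \<in> characters G" "d g \<noteq> 1" using characters_separate_points[OF assms] .
  let ?m = "\<lambda>c. \<lambda>x\<in>carrier G. d x * c x"
  have inj: "inj_on ?m (characters G)"
  proof (rule inj_onI)
    fix a b assume ab: "a \<in> characters G" "b \<in> characters G" "?m a = ?m b"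
    have "a x = b x" if "x \<in> carrier G" for x
      using fun_cong[OF ab(3), of x] that characters_norm[OF d(1) that] by auto
    then show "a = b" using ab by (intro extensionalityI[of a "carrier G"]) (auto simp: characters_def)
  qed
  have "?m ` characters G \<subseteq> characters G"
  proof (clarify)
    fix c assume c: "c \<in> characters G"
    show "?m c \<in> characters G"
      using c d by (intro char_on_carrier_imp_characters)
        (auto simp: char_on_def characters_mult characters_norm subgroup_self norm_mult)
  qed
  then have im: "?m ` characters G = characters G"
    using finite_characters[OF fin] inj by (simp add: endo_inj_surj)
  have "(\<Sum>c\<in>characters G. c g) = (\<Sum>c\<in>characters G. (?m c) g)"
    by (subst im[symmetric], subst sum.reindex[OF inj]) simp
  also have "\<dots> = d g * (\<Sum>c\<in>characters G. c g)" using g by (simp add: sum_distrib_left)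
  finally show ?thesis using d(2) by simp
qed

text \<open>On the unit circle conjugation is inversion, so each summand is
  \<open>c (x \<otimes> inv y)\<close>.\<close>

lemma (in comm_group) characters_orthogonality:
  assumes fin: "finite (carrier G)" and x: "x \<in> carrier G" and y: "y \<in> carrier G"
  shows "(\<Sum>c\<in>characters G. c x * cnj (c y)) = (if x = y then of_nat (card (characters G)) else 0)"
proof -
  have "c x * cnj (c y) = c (x \<otimes> inv y)" if c: "c \<in> characters G" for c
  proof -
    have "c (inv y) * c y = 1"
      using characters_mult[OF c, of "inv y" y] char_on_one[OF characters_char_on[OF c]] y by simp
    moreover have "cnj (c y) * c y = 1"
      using characters_norm[OF c y] complex_norm_square[of "c y"] by (simp add: mult.commute)
    moreover have "c y \<noteq> 0" using characters_norm[OF c y] by auto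
    ultimately have "c (inv y) = cnj (c y)" by (metis mult_right_cancel)
    then show ?thesis using characters_mult[OF c x, of "inv y"] y by simp
  qed
  then have "(\<Sum>c\<in>characters G. c x * cnj (c y)) = (\<Sum>c\<in>characters G. c (x \<otimes> inv y))" by simp
  also have "\<dots> = (if x = y then of_nat (card (characters G)) else 0)"
  proof (cases "x = y")
    case True
    then have "(\<Sum>c\<in>characters G. c (x \<otimes> inv y)) = (\<Sum>c\<in>characters G. 1)"
      using y by (intro sum.cong) (auto simp: char_on_one[OF characters_char_on])
    then show ?thesis using True by simp
  next
    case False
    then have "x \<otimes> inv y \<noteq> \<one>" using x y by (metis inv_equality inv_inv inv_closed)
    then show ?thesis using False x y sum_characters_eq_0[OF fin] by simp
  qed
  finally show ?thesis .
qed

section \<open>A set of characters with large determinant\<close>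

text \<open>Expand both determinants by the Leibniz formula, over permutations \<open>p\<close> and
  \<open>q\<close>. Summed over all tuples, each term factors into column inner products, which
  vanish unless \<open>p = q\<close>; the \<open>fact n\<close> diagonal terms remain.\<close>

lemma sum_norm_det_squared:
  fixes K :: "'s \<Rightarrow> nat \<Rightarrow> complex"
  assumes fin: "finite S"
    and orth: "\<And>a b. a < n \<Longrightarrow> b < n \<Longrightarrow>
      (\<Sum>c\<in>S. K c a * cnj (K c b)) = (if a = b then of_nat (card S) else 0)"
  shows "(\<Sum>f\<in>{0..<n} \<rightarrow>\<^sub>E S. (cmod (det (mat n n (\<lambda>(i, j). K (f i) j))))\<^sup>2) = fact n * real (card S) ^ n"
proof -
  let ?P = "{p. p permutes {0..<n}}"
  let ?F = "{0..<n} \<rightarrow>\<^sub>E S"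
  let ?M = "\<lambda>f. mat n n (\<lambda>(i, j). K (f i) j)"
  have finP: "finite ?P" by (simp add: finite_permutations)
  have det: "det (?M f) = (\<Sum>p\<in>?P. signof p * (\<Prod>i = 0..<n. K (f i) (p i)))" for f
    by (subst det_def'[of _ n]) (auto intro!: sum.cong prod.cong simp: permutes_in_image)
  have sq: "complex_of_real ((cmod (det (?M f)))\<^sup>2) =
      (\<Sum>p\<in>?P. \<Sum>q\<in>?P. signof p * signof q * (\<Prod>i = 0..<n. K (f i) (p i) * cnj (K (f i) (q i))))" for f
  proof -
    have "complex_of_real ((cmod (det (?M f)))\<^sup>2) = det (?M f) * cnj (det (?M f))"
      by (rule complex_norm_square)
    also have "cnj (det (?M f)) = (\<Sum>q\<in>?P. signof q * (\<Prod>i = 0..<n. cnj (K (f i) (q i))))"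
      unfolding det by (simp add: cnj_sum cnj_prod)
    also have "det (?M f) * \<dots> = (\<Sum>p\<in>?P. \<Sum>q\<in>?P. (signof p * (\<Prod>i = 0..<n. K (f i) (p i))) *
        (signof q * (\<Prod>i = 0..<n. cnj (K (f i) (q i)))))"
      unfolding det by (rule sum_product)
    finally show ?thesis unfolding prod.distrib by (simp only: mult.assoc mult.left_commute)
  qed
  have inner: "(\<Sum>f\<in>?F. \<Prod>i = 0..<n. K (f i) (p i) * cnj (K (f i) (q i))) =
      (if p = q then of_nat (card S) ^ n else 0)" if p: "p \<in> ?P" and q: "q \<in> ?P" for p q
  proof -
    \<comment> \<open>Row \<open>i\<close> depends on \<open>f i\<close> alone, so the sum over
      tuples is a product of independent sums over \<open>S\<close>.\<close>
    have "(\<Sum>f\<in>?F. \<Prod>i = 0..<n. K (f i) (p i) * cnj (K (f i) (q i))) =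
        (\<Prod>i = 0..<n. \<Sum>c\<in>S. K c (p i) * cnj (K c (q i)))"
      by (rule prod_sum_PiE[symmetric]) (use fin in auto)
    also have "\<dots> = (\<Prod>i = 0..<n. if p i = q i then of_nat (card S) else 0)"
    proof (rule prod.cong[OF refl])
      fix i assume "i \<in> {0..<n}"
      then have "p i < n" "q i < n" using p q permutes_in_image by fastforce+
      then show "(\<Sum>c\<in>S. K c (p i) * cnj (K c (q i))) = (if p i = q i then of_nat (card S) else 0)"
        by (rule orth)
    qed
    also have "\<dots> = (if p = q then of_nat (card S) ^ n else 0)"
    proof (cases "p = q")
      case False
      then obtain i where i: "p i \<noteq> q i" by blast
      then have "i \<in> {0..<n}" using p q by (metis mem_Collect_eq permutes_not_in)
      then show ?thesis using i False by (auto intro!: prod_zero)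
    qed simp
    finally show ?thesis .
  qed
  have "complex_of_real (\<Sum>f\<in>?F. (cmod (det (?M f)))\<^sup>2) =
      (\<Sum>f\<in>?F. \<Sum>p\<in>?P. \<Sum>q\<in>?P. signof p * signof q * (\<Prod>i = 0..<n. K (f i) (p i) * cnj (K (f i) (q i))))"
    by (simp only: of_real_sum sq)
  also have "\<dots> = (\<Sum>p\<in>?P. \<Sum>q\<in>?P. \<Sum>f\<in>?F. signof p * signof q * (\<Prod>i = 0..<n. K (f i) (p i) * cnj (K (f i) (q i))))"
    by (subst sum.swap, subst (2) sum.swap) simp
  also have "\<dots> = (\<Sum>p\<in>?P. \<Sum>q\<in>?P. if p = q then of_nat (card S) ^ n else 0)"
  proof (intro sum.cong refl)
    fix p q assume pq: "p \<in> ?P" "q \<in> ?P"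
    have "(\<Sum>f\<in>?F. signof p * signof q * (\<Prod>i = 0..<n. K (f i) (p i) * cnj (K (f i) (q i)))) =
        signof p * signof q * (if p = q then of_nat (card S) ^ n else 0)"
      by (simp only: sum_distrib_left[symmetric] inner[OF pq])
    also have "\<dots> = (if p = q then of_nat (card S) ^ n else 0)" by (simp add: sign_def)
    finally show "(\<Sum>f\<in>?F. signof p * signof q * (\<Prod>i = 0..<n. K (f i) (p i) * cnj (K (f i) (q i)))) =
        (if p = q then of_nat (card S) ^ n else 0)" .
  qed
  also have "\<dots> = (\<Sum>p\<in>?P. of_nat (card S) ^ n)"
    using finP by (intro sum.cong) auto
  also have "\<dots> = complex_of_real (fact n * real (card S) ^ n)"
    by (simp add: card_permutations[OF refl])
  finally show ?thesis by (simp only: of_real_eq_iff)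
qed

lemma exists_det_ge_1:
  fixes K :: "'s \<Rightarrow> nat \<Rightarrow> complex"
  assumes fin: "finite S" and ne: "S \<noteq> {}"
    and orth: "\<And>a b. a < n \<Longrightarrow> b < n \<Longrightarrow>
      (\<Sum>c\<in>S. K c a * cnj (K c b)) = (if a = b then of_nat (card S) else 0)"
  obtains f where "f \<in> {0..<n} \<rightarrow>\<^sub>E S" "1 \<le> cmod (det (mat n n (\<lambda>(i, j). K (f i) j)))"
proof -
  let ?F = "{0..<n} \<rightarrow>\<^sub>E S"
  have "\<exists>f\<in>?F. 1 \<le> cmod (det (mat n n (\<lambda>(i, j). K (f i) j)))"
  proof (rule ccontr)
    assume "\<not> ?thesis"
    then have lt: "(cmod (det (mat n n (\<lambda>(i, j). K (f i) j))))\<^sup>2 < 1" if "f \<in> ?F" for f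
      using that by (simp add: abs_square_less_1 not_le)
    \<comment> \<open>Nonemptiness makes the sum of the strict inequalities strict.\<close>
    have "finite ?F" "?F \<noteq> {}" using fin ne by (auto intro!: finite_PiE simp: PiE_eq_empty_iff)
    then have "(\<Sum>f\<in>?F. (cmod (det (mat n n (\<lambda>(i, j). K (f i) j))))\<^sup>2) < (\<Sum>f\<in>?F. 1)"
      using lt by (intro sum_strict_mono) auto
    also have "\<dots> = real (card S) ^ n" by (simp add: card_PiE)
    also have "\<dots> \<le> fact n * real (card S) ^ n"
      using fact_ge_1[of n, where ?'a = real] by (simp add: mult_le_cancel_right1)
    finally show False using sum_norm_det_squared[OF fin orth] by simp
  qed
  then show ?thesis using that by blast
qed

lemma enum_list:
  assumes "finite A" shows "distinct (enum_list A)" "set (enum_list A) = A" "length (enum_list A) = card A"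
proof -
  obtain xs where "set xs = A" "distinct xs" using finite_distinct_list[OF assms] by blast
  then have "distinct (enum_list A) \<and> set (enum_list A) = A"
    using someI[of "\<lambda>xs. distinct xs \<and> set xs = A" xs] unfolding enum_list_def by blast
  then show "distinct (enum_list A)" "set (enum_list A) = A" by auto
  then show "length (enum_list A) = card A" using distinct_card by metis
qed

text \<open>The tuple found by averaging lists its characters in another order than
  \<open>enum_list B\<close> and places them in rows instead of columns. A row permutation and a
  transposition reconcile the two without changing the modulus of the determinant.\<close>

lemma exists_char_subset_det_ge_1:
  fixes G (structure)
  assumes "comm_group G" and fin: "finite (carrier G)" and E: "E \<subseteq> carrier G"
  obtains B where "B \<in> char_subsets G E" "1 \<le> D_at E B"
proof -
  interpret comm_group G by fact
  define n where "n = card E"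
  have finE: "finite E" using E fin by (rule finite_subset)
  define x where "x = (\<lambda>i. enum_list E ! i)"
  have xE: "x i \<in> carrier G" if "i < n" for i
    using that enum_list[OF finE] E nth_mem[of i "enum_list E"] by (auto simp: x_def n_def)
  have xinj: "x i = x j \<longleftrightarrow> i = j" if "i < n" "j < n" for i j
    using that enum_list[OF finE] by (simp add: x_def n_def nth_eq_iff_index_eq)
  let ?S = "characters G"
  let ?M = "\<lambda>f. mat n n (\<lambda>(i, j). f i (x j))"
  have "(\<Sum>c\<in>?S. c (x a) * cnj (c (x b))) = (if a = b then of_nat (card ?S) else 0)"
    if "a < n" "b < n" for a b
    using characters_orthogonality[OF fin xE[OF that(1)] xE[OF that(2)]] xinj[OF that] by simp
  then obtain f where f: "f \<in> {0..<n} \<rightarrow>\<^sub>E ?S" and det: "1 \<le> cmod (det (?M f))"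
    by (rule exists_det_ge_1[OF finite_characters[OF fin] characters_nonempty, where K = "\<lambda>c a. c (x a)"])
  have inj: "inj_on f {0..<n}"
  proof (rule inj_onI, rule ccontr)
    fix i j assume ij: "i \<in> {0..<n}" "j \<in> {0..<n}" "f i = f j" "i \<noteq> j"
    have "det (?M f) = 0"
      by (rule det_identical_rows[of _ n i j]) (use ij in \<open>auto intro!: eq_vecI\<close>)
    then show False using det by simp
  qed
  define B where "B = f ` {0..<n}"
  have finB: "finite B" and cardB: "card B = n" using inj by (auto simp: B_def card_image)
  have BS: "B \<in> char_subsets G E" using f cardB by (auto simp: char_subsets_def B_def n_def)
  define b where "b = (\<lambda>i. enum_list B ! i)"
  have "bij_betw b {0..<n} B"
    using bij_betw_nth[OF enum_list(1)[OF finB], of "{0..<n}" B] enum_list[OF finB] cardB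
    by (simp add: b_def atLeast0LessThan)
  moreover have "bij_betw f {0..<n} B" using inj by (simp add: B_def bij_betw_def)
  ultimately have bij: "bij_betw (the_inv_into {0..<n} f \<circ> b) {0..<n} {0..<n}"
    using bij_betw_the_inv_into bij_betw_trans by blast
  \<comment> \<open>Position in the tuple of the \<open>i\<close>-th character of
    \<open>enum_list B\<close>, continued by the identity because \<open>permutes\<close> demands
    fixed points outside the set.\<close>
  define p where "p = (\<lambda>i. if i \<in> {0..<n} then (the_inv_into {0..<n} f \<circ> b) i else i)"
  have p: "p permutes {0..<n}"
  proof (rule bij_imp_permutes)
    show "bij_betw p {0..<n} {0..<n}"
      using bij by (rule bij_betw_cong[THEN iffD1, rotated]) (simp add: p_def)
  qed (simp add: p_def)
  have bp: "b i = f (p i)" if "i < n" for i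
  proof -
    have "b i \<in> f ` {0..<n}" using that enum_list[OF finB] cardB nth_mem[of i "enum_list B"]
      by (simp add: b_def B_def[symmetric])
    then show ?thesis using that inj by (simp add: p_def f_the_inv_into_f)
  qed
  have pn: "p i < n" if "i < n" for i using permutes_in_image[OF p, of i] that by simp
  have "T E B = transpose_mat (mat n n (\<lambda>(i, j). ?M f $$ (p i, j)))"
    by (rule eq_matI) (auto simp: T_def n_def[symmetric] cardB b_def[symmetric] x_def[symmetric] bp pn)
  then have "det (T E B) = signof p * det (?M f)"
    using det_permute_rows[of "?M f" n p] p by (simp add: det_transpose[of _ n])
  then have "D_at E B = cmod (det (?M f))"
    by (simp add: D_at_def norm_mult sign_def)
  then show ?thesis using that BS det by simp
qed

section \<open>Eigenvalues of the Gram matrix\<close>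

lemma vec_norm2_eq_L2_set: "vec_norm2 v = L2_set (\<lambda>i. cmod (v $ i)) {..<dim_vec v}"
  by (simp add: vec_norm2_def L2_set_def)

lemma vec_norm2_nonneg: "0 \<le> vec_norm2 v"
  by (simp add: vec_norm2_eq_L2_set)

lemma vec_norm2_square: "(vec_norm2 v)\<^sup>2 = (\<Sum>i<dim_vec v. (cmod (v $ i))\<^sup>2)"
  by (simp add: vec_norm2_def sum_nonneg)

lemma vec_norm2_eq_0_iff:
  assumes "v \<in> carrier_vec n" shows "vec_norm2 v = 0 \<longleftrightarrow> v = 0\<^sub>v n"
  using assms by (auto simp: vec_norm2_eq_L2_set L2_set_eq_0_iff intro!: eq_vecI)

lemma vec_norm2_smult: "vec_norm2 (c \<cdot>\<^sub>v v) = cmod c * vec_norm2 v"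
  by (simp add: vec_norm2_eq_L2_set norm_mult L2_set_right_distrib cong: L2_set_cong_simp)

lemma cscalar_prod_self: "v \<bullet>c v = complex_of_real ((vec_norm2 v)\<^sup>2)"
  by (simp add: vec_norm2_square scalar_prod_def complex_norm_square atLeast0LessThan del: of_real_power)

lemma norm_scalar_prod_le:
  assumes "dim_vec v = dim_vec w" shows "cmod (v \<bullet> w) \<le> vec_norm2 v * vec_norm2 w"
proof -
  have "cmod (v \<bullet> w) \<le> (\<Sum>i<dim_vec w. \<bar>cmod (v $ i)\<bar> * \<bar>cmod (w $ i)\<bar>)"
    by (simp add: scalar_prod_def atLeast0LessThan sum_norm_le norm_mult)
  also have "\<dots> \<le> vec_norm2 v * vec_norm2 w"
    unfolding vec_norm2_eq_L2_set assms by (rule L2_set_mult_ineq)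
  finally show ?thesis .
qed

lemma vec_norm2_conjugate: "vec_norm2 (conjugate v) = vec_norm2 v"
  by (simp add: vec_norm2_def)

lemma norm_cscalar_prod_le:
  assumes "dim_vec v = dim_vec w" shows "cmod (v \<bullet>c w) \<le> vec_norm2 v * vec_norm2 w"
  using norm_scalar_prod_le[of v "conjugate w"] assms by (simp add: vec_norm2_conjugate)

lemma vec_norm2_diff_square:
  assumes "u \<in> carrier_vec n" "w \<in> carrier_vec n"
  shows "(vec_norm2 (u - w))\<^sup>2 = (vec_norm2 u)\<^sup>2 - 2 * Re (u \<bullet>c w) + (vec_norm2 w)\<^sup>2"
proof -
  have "(cmod (a - b))\<^sup>2 = (cmod a)\<^sup>2 - 2 * Re (a * cnj b) + (cmod b)\<^sup>2" for a b
    unfolding cmod_power2 by (simp add: power2_eq_square algebra_simps)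
  then show ?thesis using assms
    by (simp add: vec_norm2_square scalar_prod_def atLeast0LessThan sum.distrib sum_subtractf
        sum_distrib_left)
qed

lemma mat_adjoint_carrier: "A \<in> carrier_mat m n \<Longrightarrow> mat_adjoint A \<in> carrier_mat n m"
  by (auto simp: mat_adjoint_def mat_of_rows_def)

lemma mat_adjoint_index:
  "A \<in> carrier_mat m n \<Longrightarrow> i < n \<Longrightarrow> j < m \<Longrightarrow> mat_adjoint A $$ (i, j) = cnj (A $$ (j, i))"
  for A :: "complex mat"
  by (auto simp: mat_adjoint_def mat_of_rows_index)

lemma mat_adjoint_cscalar_prod:
  fixes A :: "complex mat"
  assumes A: "A \<in> carrier_mat m n" and v: "v \<in> carrier_vec n" and w: "w \<in> carrier_vec m"
  shows "(mat_adjoint A *\<^sub>v w) \<bullet>c v = w \<bullet>c (A *\<^sub>v v)"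
proof -
  note A' = mat_adjoint_carrier[OF A]
  have "(mat_adjoint A *\<^sub>v w) \<bullet>c v = (\<Sum>i<n. \<Sum>j<m. cnj (A $$ (j, i)) * w $ j * cnj (v $ i))"
    using A A' v w by (simp add: scalar_prod_def atLeast0LessThan mat_adjoint_index sum_distrib_right)
  also have "\<dots> = (\<Sum>j<m. \<Sum>i<n. cnj (A $$ (j, i)) * w $ j * cnj (v $ i))" by (rule sum.swap)
  also have "\<dots> = w \<bullet>c (A *\<^sub>v v)"
    using A v w by (simp add: scalar_prod_def atLeast0LessThan sum_distrib_left mult_ac)
  finally show ?thesis .
qed

section \<open>The operator norm as a spectral quantity\<close>

lemma vec_norm2_mult_mat_vec_bounded:
  fixes A :: "complex mat"
  obtains c where "c > 0" "\<And>v. v \<in> carrier_vec (dim_col A) \<Longrightarrow> vec_norm2 (A *\<^sub>v v) \<le> c * vec_norm2 v"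
proof -
  define c where "c = (\<Sum>i<dim_row A. vec_norm2 (row A i))"
  \<comment> \<open>The sum of the row norms is a bound by Cauchy-Schwarz; adding 1 keeps the
    constant positive even for a zero matrix.\<close>
  have "vec_norm2 (A *\<^sub>v v) \<le> (c + 1) * vec_norm2 v" if v: "v \<in> carrier_vec (dim_col A)" for v
  proof -
    have "vec_norm2 (A *\<^sub>v v) \<le> (\<Sum>i<dim_row A. cmod ((A *\<^sub>v v) $ i))"
      unfolding vec_norm2_eq_L2_set dim_mult_mat_vec by (rule L2_set_le_sum) (rule norm_ge_zero)
    also have "\<dots> \<le> (\<Sum>i<dim_row A. vec_norm2 (row A i) * vec_norm2 v)"
      using v by (intro sum_mono) (auto intro: norm_scalar_prod_le)
    also have "\<dots> \<le> (c + 1) * vec_norm2 v"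
      by (simp add: c_def sum_distrib_right[symmetric] vec_norm2_nonneg mult_right_mono)
    finally show ?thesis .
  qed
  moreover have "c \<ge> 0" by (simp add: c_def sum_nonneg vec_norm2_nonneg)
  ultimately show ?thesis using that[of "c + 1"] by simp
qed

lemma vec_norm2_mult_mat_vec_le:
  fixes A :: "complex mat"
  assumes v: "v \<in> carrier_vec (dim_col A)"
  shows "vec_norm2 (A *\<^sub>v v) \<le> op_norm2 A * vec_norm2 v"
proof -
  let ?V = "{v \<in> carrier_vec (dim_col A). vec_norm2 v \<le> 1}"
  obtain c where c: "c > 0" "\<And>v. v \<in> carrier_vec (dim_col A) \<Longrightarrow> vec_norm2 (A *\<^sub>v v) \<le> c * vec_norm2 v"
    using vec_norm2_mult_mat_vec_bounded[of A] by blast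
  \<comment> \<open>A real supremum dominates its family only once the family is known to be
    bounded.\<close>
  have "bdd_above ((\<lambda>v. vec_norm2 (A *\<^sub>v v)) ` ?V)"
  proof (rule bdd_aboveI2)
    fix u assume "u \<in> ?V"
    then have "vec_norm2 (A *\<^sub>v u) \<le> c * vec_norm2 u" "c * vec_norm2 u \<le> c"
      using c by (auto intro: mult_left_le)
    then show "vec_norm2 (A *\<^sub>v u) \<le> c" by linarith
  qed
  then have up: "vec_norm2 (A *\<^sub>v u) \<le> op_norm2 A" if "u \<in> ?V" for u
    unfolding op_norm2_def using that by (rule cSUP_upper[rotated])
  show ?thesis
  proof (cases "vec_norm2 v = 0")
    case True
    then show ?thesis using c(2)[OF v] by simp
  next
    case False
    then have pos: "vec_norm2 v > 0" using vec_norm2_nonneg[of v] by simp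
    let ?u = "complex_of_real (1 / vec_norm2 v) \<cdot>\<^sub>v v"
    have "vec_norm2 ?u = 1" using pos unfolding vec_norm2_smult norm_of_real by simp
    then have "vec_norm2 (A *\<^sub>v ?u) \<le> op_norm2 A" using v by (intro up) auto
    moreover have "A *\<^sub>v ?u = complex_of_real (1 / vec_norm2 v) \<cdot>\<^sub>v (A *\<^sub>v v)"
      using v by (intro mult_mat_vec[of A "dim_row A" "dim_col A"]) auto
    moreover have "vec_norm2 (complex_of_real (1 / vec_norm2 v) \<cdot>\<^sub>v (A *\<^sub>v v)) = 1 / vec_norm2 v * vec_norm2 (A *\<^sub>v v)"
      using pos unfolding vec_norm2_smult norm_of_real by simp
    ultimately have "1 / vec_norm2 v * vec_norm2 (A *\<^sub>v v) \<le> op_norm2 A" by (simp only:)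
    then show ?thesis using pos by (simp add: field_simps)
  qed
qed

lemma op_norm2_least:
  fixes A :: "complex mat"
  assumes "c \<ge> 0" "\<And>v. v \<in> carrier_vec (dim_col A) \<Longrightarrow> vec_norm2 (A *\<^sub>v v) \<le> c * vec_norm2 v"
  shows "op_norm2 A \<le> c"
  unfolding op_norm2_def
proof (rule cSUP_least)
  have "0\<^sub>v (dim_col A) \<in> {v \<in> carrier_vec (dim_col A). vec_norm2 v \<le> 1}"
    using vec_norm2_eq_0_iff[of "0\<^sub>v (dim_col A)" "dim_col A"] by simp
  then show "{v \<in> carrier_vec (dim_col A). vec_norm2 v \<le> 1} \<noteq> {}" by blast
  fix v assume "v \<in> {v \<in> carrier_vec (dim_col A). vec_norm2 v \<le> 1}"
  then have "vec_norm2 (A *\<^sub>v v) \<le> c * vec_norm2 v" "c * vec_norm2 v \<le> c"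
    using assms by (auto intro: mult_left_le)
  then show "vec_norm2 (A *\<^sub>v v) \<le> c" by linarith
qed

lemma vec_norm2_unit_vec:
  assumes "i < n" shows "vec_norm2 (unit_vec n i) = 1"
proof -
  have "(\<Sum>j<n. (cmod (unit_vec n i $ j))\<^sup>2) = (\<Sum>j<n. if j = i then 1 else 0)"
    using assms by (intro sum.cong) (auto simp: unit_vec_def)
  then show ?thesis using assms by (simp add: vec_norm2_def)
qed

lemma op_norm2_nonneg: "0 \<le> op_norm2 A" if "dim_col A > 0"
proof -
  have "vec_norm2 (A *\<^sub>v unit_vec (dim_col A) 0) \<le> op_norm2 A * vec_norm2 (unit_vec (dim_col A) 0)"
    by (rule vec_norm2_mult_mat_vec_le) simp
  then show ?thesis
    using that vec_norm2_nonneg[of "A *\<^sub>v unit_vec (dim_col A) 0"]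
    by (simp add: vec_norm2_unit_vec)
qed

text \<open>With \<open>u\<close> the image of \<open>w\<close> under the adjoint, the square of
  \<open>vec_norm2 u\<close> is the inner product of \<open>w\<close> and
  \<open>A *\<^sub>v u\<close>; Cauchy-Schwarz bounds it, and one factor \<open>vec_norm2 u\<close>
  cancels.\<close>

lemma vec_norm2_mat_adjoint_mult_le:
  assumes A: "A \<in> carrier_mat m n" and n: "n > 0" and w: "w \<in> carrier_vec m"
  shows "vec_norm2 (mat_adjoint A *\<^sub>v w) \<le> op_norm2 A * vec_norm2 w"
proof -
  let ?u = "mat_adjoint A *\<^sub>v w"
  have u: "?u \<in> carrier_vec n" using mat_adjoint_carrier[OF A] w by (rule mult_mat_vec_carrier)
  have "(vec_norm2 ?u)\<^sup>2 = cmod (?u \<bullet>c ?u)" by (simp add: cscalar_prod_self norm_power vec_norm2_nonneg)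
  also have "\<dots> = cmod (w \<bullet>c (A *\<^sub>v ?u))" using mat_adjoint_cscalar_prod[OF A u w] by simp
  also have "\<dots> \<le> vec_norm2 w * vec_norm2 (A *\<^sub>v ?u)" using A w by (intro norm_cscalar_prod_le) auto
  also have "\<dots> \<le> vec_norm2 w * (op_norm2 A * vec_norm2 ?u)"
    using A u by (intro mult_left_mono vec_norm2_mult_mat_vec_le vec_norm2_nonneg) auto
  finally have "vec_norm2 ?u * vec_norm2 ?u \<le> (op_norm2 A * vec_norm2 w) * vec_norm2 ?u"
    by (simp add: power2_eq_square mult_ac)
  then show ?thesis
    using vec_norm2_nonneg[of ?u] op_norm2_nonneg[of A] vec_norm2_nonneg[of w] A n
    by (cases "vec_norm2 ?u = 0") auto
qed

text \<open>For \<open>s = op_norm2 A\<close> and \<open>H = A\<^sup>* A - s\<^sup>2\<close> one has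
  \<open>\<parallel>H v\<parallel>\<^sup>2 \<le> s\<^sup>2 (s\<^sup>2 \<parallel>v\<parallel>\<^sup>2 - \<parallel>A v\<parallel>\<^sup>2)\<close>, so an inverse of \<open>H\<close> would bound \<open>\<parallel>A v\<parallel> / \<parallel>v\<parallel>\<close> away from \<open>s\<close>.\<close>

lemma op_norm2_square_eigenvalue:
  assumes A: "A \<in> carrier_mat n n" and n: "n > 0"
  shows "eigenvalue (mat_adjoint A * A) (complex_of_real ((op_norm2 A)\<^sup>2))"
proof (rule ccontr)
  assume ne: "\<not> ?thesis"
  define s where "s = op_norm2 A"
  define g where "g = mat_adjoint A * A"
  define H where "H = char_matrix g (complex_of_real (s\<^sup>2))"
  note A' = mat_adjoint_carrier[OF A]
  have g: "g \<in> carrier_mat n n" using A A' by (simp add: g_def)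
  have s0: "s \<ge> 0" using A n op_norm2_nonneg[of A] by (simp add: s_def)
  have H: "H \<in> carrier_mat n n" using g by (simp add: H_def)
  have "det H \<noteq> 0" using ne eigenvalue_det[OF g] by (simp add: H_def s_def g_def)
  from det_non_zero_imp_unit[OF H this, of "()"] obtain C where C: "C \<in> carrier_mat n n" "C * H = 1\<^sub>m n"
    by (auto simp: Units_def ring_mat_simps)
  obtain c where c: "c > 0" "\<And>v. v \<in> carrier_vec (dim_col C) \<Longrightarrow> vec_norm2 (C *\<^sub>v v) \<le> c * vec_norm2 v"
    using vec_norm2_mult_mat_vec_bounded[of C] by blast
  have key: "(vec_norm2 v)\<^sup>2 \<le> c\<^sup>2 * (s\<^sup>2 * (s\<^sup>2 * (vec_norm2 v)\<^sup>2 - (vec_norm2 (A *\<^sub>v v))\<^sup>2))"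
    if v: "v \<in> carrier_vec n" for v
  proof -
    let ?z = "complex_of_real (s\<^sup>2)"
    have Av: "A *\<^sub>v v \<in> carrier_vec n" and gv: "g *\<^sub>v v \<in> carrier_vec n"
      and Hv: "H *\<^sub>v v \<in> carrier_vec n" using A g H v by auto
    have gv_eq: "g *\<^sub>v v = mat_adjoint A *\<^sub>v (A *\<^sub>v v)" using A A' v by (simp add: g_def)
    have "H *\<^sub>v v = g *\<^sub>v v - ?z \<cdot>\<^sub>v v"
      using g v by (intro eq_vecI)
        (auto simp: H_def char_matrix_def scalar_prod_def algebra_simps sum.distrib
          sum_negf sum.delta if_distrib[of "\<lambda>x. x * _"] if_distrib[of "\<lambda>x. _ * x"] cong: if_cong)
    then have "(vec_norm2 (H *\<^sub>v v))\<^sup>2 =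
        (vec_norm2 (g *\<^sub>v v))\<^sup>2 - 2 * Re ((g *\<^sub>v v) \<bullet>c (?z \<cdot>\<^sub>v v)) + (vec_norm2 (?z \<cdot>\<^sub>v v))\<^sup>2"
      using vec_norm2_diff_square[OF gv, of "?z \<cdot>\<^sub>v v"] v by simp
    also have "(g *\<^sub>v v) \<bullet>c (?z \<cdot>\<^sub>v v) = ?z * ((g *\<^sub>v v) \<bullet>c v)"
      using g v by (simp add: scalar_prod_def sum_distrib_left mult_ac)
    also have "(g *\<^sub>v v) \<bullet>c v = complex_of_real ((vec_norm2 (A *\<^sub>v v))\<^sup>2)"
      using mat_adjoint_cscalar_prod[OF A v Av] unfolding gv_eq by (simp only: cscalar_prod_self)
    also have "vec_norm2 (?z \<cdot>\<^sub>v v) = s\<^sup>2 * vec_norm2 v"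
      unfolding vec_norm2_smult norm_of_real by simp
    also have "(vec_norm2 (g *\<^sub>v v))\<^sup>2 \<le> (s * vec_norm2 (A *\<^sub>v v))\<^sup>2"
      unfolding gv_eq s_def
      by (intro power_mono vec_norm2_mat_adjoint_mult_le[OF A n Av] vec_norm2_nonneg)
    \<comment> \<open>The cross term contributes minus twice
      \<open>s\<^sup>2 * (vec_norm2 (A *\<^sub>v v))\<^sup>2\<close>, and the bound for
      \<open>g *\<^sub>v v\<close> gives back one of the two.\<close>
    finally have Hle: "(vec_norm2 (H *\<^sub>v v))\<^sup>2 \<le> s\<^sup>2 * (s\<^sup>2 * (vec_norm2 v)\<^sup>2 - (vec_norm2 (A *\<^sub>v v))\<^sup>2)"
      by (simp add: algebra_simps power2_eq_square)
    have "C *\<^sub>v (H *\<^sub>v v) = v" using C H v by (simp flip: assoc_mult_mat_vec)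
    then have "vec_norm2 v \<le> c * vec_norm2 (H *\<^sub>v v)" using c(2)[of "H *\<^sub>v v"] C Hv by simp
    then have "(vec_norm2 v)\<^sup>2 \<le> (c * vec_norm2 (H *\<^sub>v v))\<^sup>2"
      using vec_norm2_nonneg by (intro power_mono)
    also have "\<dots> = c\<^sup>2 * (vec_norm2 (H *\<^sub>v v))\<^sup>2" by (rule power_mult_distrib)
    also have "\<dots> \<le> c\<^sup>2 * (s\<^sup>2 * (s\<^sup>2 * (vec_norm2 v)\<^sup>2 - (vec_norm2 (A *\<^sub>v v))\<^sup>2))"
      using Hle by (intro mult_left_mono) auto
    finally show ?thesis .
  qed
  let ?e = "unit_vec n 0 :: complex vec"
  have e: "vec_norm2 ?e > 0" "?e \<in> carrier_vec n"
    using n by (simp_all add: vec_norm2_unit_vec)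
  have "s \<noteq> 0" using key[OF e(2)] e(1) by auto
  then have s: "s > 0" using s0 by simp
  \<comment> \<open>Solving \<open>key\<close> for the norm of \<open>A *\<^sub>v v\<close> yields
    this constant, strictly below \<open>s\<^sup>2\<close>, which contradicts the minimality of
    \<open>s\<close> as a bound.\<close>
  define r where "r = s\<^sup>2 - 1 / (c\<^sup>2 * s\<^sup>2)"
  have r: "(vec_norm2 (A *\<^sub>v v))\<^sup>2 \<le> r * (vec_norm2 v)\<^sup>2" if "v \<in> carrier_vec n" for v
    using key[OF that] s c(1) by (simp add: r_def field_simps)
  have "0 \<le> r * (vec_norm2 ?e)\<^sup>2" using r[OF e(2)] by (meson order_trans zero_le_power2)
  then have r0: "r \<ge> 0" using e(1) by (simp add: zero_le_mult_iff)
  have "s \<le> sqrt r"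
    unfolding s_def
  proof (rule op_norm2_least)
    fix v :: "complex vec" assume "v \<in> carrier_vec (dim_col A)"
    then have "(vec_norm2 (A *\<^sub>v v))\<^sup>2 \<le> (sqrt r * vec_norm2 v)\<^sup>2"
      using r[of v] A r0 by (simp add: power_mult_distrib)
    then show "vec_norm2 (A *\<^sub>v v) \<le> sqrt r * vec_norm2 v"
      by (rule power2_le_imp_le) (simp add: r0 vec_norm2_nonneg)
  qed (use r0 in simp)
  then have "s\<^sup>2 \<le> (sqrt r)\<^sup>2" using s by (intro power_mono) auto
  then have "s\<^sup>2 \<le> r" using r0 by simp
  moreover have "r < s\<^sup>2" using s c(1) by (simp add: r_def)
  ultimately show False by simp
qed

section \<open>Eigenvalues with multiplicity, trace and determinant\<close>

lemma sum_diag_mult_commute: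
  fixes A B :: "'a :: comm_semiring_0 mat"
  assumes "A \<in> carrier_mat n m" "B \<in> carrier_mat m n"
  shows "(\<Sum>i<n. (A * B) $$ (i, i)) = (\<Sum>i<m. (B * A) $$ (i, i))"
proof -
  have "(\<Sum>i<n. (A * B) $$ (i, i)) = (\<Sum>i<n. \<Sum>j<m. A $$ (i, j) * B $$ (j, i))"
    using assms by (simp add: scalar_prod_def atLeast0LessThan)
  also have "\<dots> = (\<Sum>j<m. \<Sum>i<n. A $$ (i, j) * B $$ (j, i))" by (rule sum.swap)
  also have "\<dots> = (\<Sum>i<m. (B * A) $$ (i, i))"
    using assms by (simp add: scalar_prod_def atLeast0LessThan mult.commute)
  finally show ?thesis .
qed

text \<open>The diagonal of a Schur form lists the roots of the characteristic polynomial with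
  multiplicity; trace and determinant are invariant under similarity.\<close>

lemma eigenvalue_list:
  fixes A :: "complex mat"
  assumes A: "A \<in> carrier_mat n n"
  obtains e where "\<And>k. eigenvalue A k \<longleftrightarrow> (\<exists>i<n. k = e i)"
    "(\<Sum>i<n. e i) = (\<Sum>i<n. A $$ (i, i))" "(\<Prod>i<n. e i) = det A"
proof -
  obtain es where es: "char_poly A = (\<Prod>a\<leftarrow>es. [:- a, 1:])" "length es = n"
    using char_poly_factorized[OF A] by blast
  obtain B P Q where "schur_decomposition A es = (B, P, Q)" by (metis prod_cases3)
  from schur_decomposition[OF A es(1) this] have wit: "similar_mat_wit A B P Q"
    and B: "upper_triangular B" "diag_mat B = es" by auto
  note w = similar_mat_witD2[OF A wit]
  have Bi: "B $$ (i, i) = es ! i" if "i < n" for i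
    using that w(5) B(2) by (auto simp: diag_mat_def)
  have "eigenvalue A k \<longleftrightarrow> (\<exists>i<n. k = es ! i)" for k
  proof -
    have "eigenvalue A k \<longleftrightarrow> k \<in> set es"
      unfolding eigenvalue_root_char_poly[OF A] es(1) poly_prod_list
      by (auto simp: prod_list_zero_iff)
    then show ?thesis using es(2) by (auto simp: in_set_conv_nth)
  qed
  moreover have "(\<Sum>i<n. es ! i) = (\<Sum>i<n. A $$ (i, i))"
  proof -
    have "(\<Sum>i<n. A $$ (i, i)) = (\<Sum>i<n. (P * (B * Q)) $$ (i, i))"
      using w by (simp add: assoc_mult_mat[of _ n n _ n _ n])
    also have "\<dots> = (\<Sum>i<n. (B * Q * P) $$ (i, i))" using w by (intro sum_diag_mult_commute) auto
    also have "B * Q * P = B" using w by (simp add: assoc_mult_mat[of _ n n _ n _ n])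
    finally show ?thesis by (simp add: Bi)
  qed
  moreover have "(\<Prod>i<n. es ! i) = det A"
  proof -
    have "similar_mat A B" using wit by (auto simp: similar_mat_def)
    then have "det A = prod_list es" using det_similar det_upper_triangular[OF B(1) w(5)] B(2) by metis
    then show ?thesis using es(2) by (simp add: prod.list_conv_set_nth atLeast0LessThan)
  qed
  ultimately show ?thesis using that by blast
qed

lemma det_mat_adjoint:
  fixes A :: "complex mat"
  assumes A: "A \<in> carrier_mat n n" shows "det (mat_adjoint A) = cnj (det A)"
proof -
  have "mat_adjoint A = transpose_mat (map_mat cnj A)"
    using A mat_adjoint_carrier[OF A] by (intro eq_matI) (auto simp: mat_adjoint_index)
  then have "det (mat_adjoint A) = det (map_mat cnj A)" using A by (simp add: det_transpose[of _ n])
  also have "\<dots> = cnj (det A)"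
    using A by (auto simp: det_def'[of _ n] cnj_sum cnj_prod permutes_in_image intro!: sum.cong prod.cong)
  finally show ?thesis .
qed

text \<open>Pairing \<open>A\<^sup>* A v = e v\<close> with \<open>v\<close> shows that
  \<open>e\<close> is the squared ratio of the norms of \<open>A v\<close> and \<open>v\<close>,
  hence real and nonnegative. The trace of the Gram matrix is the sum of the squared moduli of all
  entries.\<close>

lemma gram_eigenvalues:
  fixes A :: "complex mat"
  assumes A: "A \<in> carrier_mat n n"
  obtains l :: "nat \<Rightarrow> real" where "\<And>i. i < n \<Longrightarrow> 0 \<le> l i"
    "\<And>k. eigenvalue (mat_adjoint A * A) k \<longleftrightarrow> (\<exists>i<n. k = complex_of_real (l i))"
    "(\<Sum>i<n. l i) = (\<Sum>i<n. \<Sum>j<n. (cmod (A $$ (j, i)))\<^sup>2)"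
    "(\<Prod>i<n. l i) = (cmod (det A))\<^sup>2"
proof -
  define g where "g = mat_adjoint A * A"
  note A' = mat_adjoint_carrier[OF A]
  have g: "g \<in> carrier_mat n n" using A A' by (simp add: g_def)
  obtain e where e: "\<And>k. eigenvalue g k \<longleftrightarrow> (\<exists>i<n. k = e i)"
    "(\<Sum>i<n. e i) = (\<Sum>i<n. g $$ (i, i))" "(\<Prod>i<n. e i) = det g"
    using eigenvalue_list[OF g] by blast
  have real: "e i = complex_of_real (Re (e i)) \<and> 0 \<le> Re (e i)" if "i < n" for i
  proof -
    have "eigenvalue g (e i)" using e(1) that by blast
    then obtain v where v: "v \<in> carrier_vec n" "v \<noteq> 0\<^sub>v n" "g *\<^sub>v v = e i \<cdot>\<^sub>v v"
      using g by (auto simp: eigenvalue_def eigenvector_def)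
    have "(g *\<^sub>v v) \<bullet>c v = complex_of_real ((vec_norm2 (A *\<^sub>v v))\<^sup>2)"
      using mat_adjoint_cscalar_prod[OF A v(1), of "A *\<^sub>v v"] A A' v(1)
      unfolding cscalar_prod_self[symmetric] by (simp add: g_def)
    then have eq: "e i * complex_of_real ((vec_norm2 v)\<^sup>2) = complex_of_real ((vec_norm2 (A *\<^sub>v v))\<^sup>2)"
      using v by (simp add: cscalar_prod_self)
    have "(vec_norm2 v)\<^sup>2 > 0" using vec_norm2_eq_0_iff[OF v(1)] v(2) by simp
    then have "e i = complex_of_real ((vec_norm2 (A *\<^sub>v v))\<^sup>2 / (vec_norm2 v)\<^sup>2)"
      using eq by (simp add: field_simps)
    then show ?thesis by (metis Re_complex_of_real divide_nonneg_nonneg zero_le_power2)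
  qed
  define l where "l = (\<lambda>i. Re (e i))"
  have el: "e i = complex_of_real (l i)" if "i < n" for i using real[OF that] by (simp add: l_def)
  have "complex_of_real (\<Sum>i<n. l i) = (\<Sum>i<n. g $$ (i, i))" using e(2) el by simp
  also have "\<dots> = complex_of_real (\<Sum>i<n. \<Sum>j<n. (cmod (A $$ (j, i)))\<^sup>2)"
    using A A' by (simp add: g_def scalar_prod_def atLeast0LessThan mat_adjoint_index
        complex_norm_square mult.commute del: of_real_power)
  finally have "(\<Sum>i<n. l i) = (\<Sum>i<n. \<Sum>j<n. (cmod (A $$ (j, i)))\<^sup>2)" by (simp only: of_real_eq_iff)
  moreover have "complex_of_real (\<Prod>i<n. l i) = complex_of_real ((cmod (det A))\<^sup>2)"
    using e(3) el A A' by (simp add: g_def det_mult det_mat_adjoint complex_norm_square mult.commute del: of_real_power)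
  then have "(\<Prod>i<n. l i) = (cmod (det A))\<^sup>2" by (simp only: of_real_eq_iff)
  moreover have "eigenvalue g k \<longleftrightarrow> (\<exists>i<n. k = complex_of_real (l i))" for k
    using e(1) el by auto
  moreover have "0 \<le> l i" if "i < n" for i using real[OF that] by (simp add: l_def)
  ultimately show ?thesis using that unfolding g_def by blast
qed

section \<open>Numbers with prescribed sum and product at least one\<close>

text \<open>Polya's proof of the inequality of means: apply \<open>t \<le> exp (t - 1)\<close> to
  each \<open>x i / a\<close> with \<open>a\<close> the mean; the exponents add up to 0.\<close>

lemma prod_le_mean_power:
  fixes x :: "'i \<Rightarrow> real"
  assumes "finite I" "I \<noteq> {}" and pos: "\<And>i. i \<in> I \<Longrightarrow> x i > 0"
  shows "prod x I \<le> (sum x I / real (card I)) ^ card I"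
proof -
  define a where "a = sum x I / real (card I)"
  have card: "real (card I) > 0" using assms by (simp add: card_gt_0_iff)
  have "sum x I > 0" using assms by (intro sum_pos) auto
  then have a: "a > 0" using card by (simp add: a_def)
  have "(\<Prod>i\<in>I. x i / a) \<le> (\<Prod>i\<in>I. exp (x i / a - 1))"
  proof (rule prod_mono)
    fix i assume "i \<in> I"
    then show "0 \<le> x i / a \<and> x i / a \<le> exp (x i / a - 1)"
      using pos a exp_ge_add_one_self[of "x i / a - 1"] by (simp add: less_imp_le)
  qed
  also have "\<dots> = exp (\<Sum>i\<in>I. x i / a - 1)" using assms(1) by (simp add: exp_sum)
  also have "(\<Sum>i\<in>I. x i / a - 1) = sum x I / a - real (card I)"
    by (simp add: sum_subtractf sum_divide_distrib)
  also have "\<dots> = 0" using card \<open>sum x I > 0\<close> by (simp add: a_def)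
  finally have "prod x I / a ^ card I \<le> 1" by (simp add: prod_dividef)
  then show ?thesis using a by (simp add: a_def[symmetric])
qed

lemma one_plus_inverse_power_le_exp:
  assumes "m > (0::nat)" shows "((real m + 1) / real m) ^ m \<le> exp 1"
proof -
  have "(real m + 1) / real m \<le> exp (1 / real m)"
    using exp_ge_add_one_self[of "1 / real m"] assms by (simp add: field_simps)
  then have "((real m + 1) / real m) ^ m \<le> exp (1 / real m) ^ m" by (intro power_mono) auto
  also have "\<dots> = exp 1" using assms by (simp flip: exp_of_nat_mult)
  finally show ?thesis .
qed

text \<open>Source of the 1/4 in the bound for \<open>U\<close>; equality holds at
  \<open>n = 2\<close>, where the induction starts.\<close>

lemma square_le_four_power:
  assumes "n \<ge> (2::nat)" shows "(real n)\<^sup>2 \<le> 4 ^ (n - 1)"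
  using assms
proof (induction n rule: dec_induct)
  case (step n)
  have "(real n + 1)\<^sup>2 \<le> (2 * real n)\<^sup>2" using step by (intro power_mono) auto
  also have "\<dots> \<le> 4 * 4 ^ (n - 1)" using step by (simp add: power_mult_distrib)
  also have "\<dots> = 4 ^ n" using step by (cases n) auto
  finally show ?case by (simp add: add.commute)
qed simp

text \<open>The family \<open>l\<close> stands for the eigenvalues of the Gram matrix, repeated by
  multiplicity; the sum is its trace and the product its determinant.\<close>

locale spectrum =
  fixes I :: "'i set" and l :: "'i \<Rightarrow> real" and n :: nat
  assumes fin: "finite I" and card: "card I = n" and n: "n > 1"
    and pos: "\<And>i. i \<in> I \<Longrightarrow> l i > 0"
    and sum: "sum l I = (real n)\<^sup>2" and prod: "prod l I \<ge> 1"
begin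

text \<open>Split off \<open>l i\<close> and apply the inequality of means to the other
  \<open>n - 1\<close> values, which exist and are positive because \<open>n > 1\<close>.\<close>

lemma others:
  assumes "i \<in> I"
  shows "l i < (real n)\<^sup>2" and "1 \<le> l i * (((real n)\<^sup>2 - l i) / (real n - 1)) ^ (n - 1)"
proof -
  let ?J = "I - {i}"
  have cJ: "card ?J = n - 1" using fin card assms by simp
  have J: "finite ?J" "?J \<noteq> {}" using fin cJ n by (simp, metis card.empty zero_less_diff less_irrefl)
  have sJ: "sum l ?J = (real n)\<^sup>2 - l i" using sum fin assms by (simp add: sum_diff1)
  have "sum l ?J > 0" using J pos by (intro sum_pos) auto
  then show "l i < (real n)\<^sup>2" using sJ by simp
  have "1 \<le> l i * prod l ?J" using prod fin assms by (simp add: prod.remove)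
  also have "\<dots> \<le> l i * (sum l ?J / real (card ?J)) ^ card ?J"
    using pos[OF assms] pos J by (intro mult_left_mono prod_le_mean_power) auto
  finally show "1 \<le> l i * (((real n)\<^sup>2 - l i) / (real n - 1)) ^ (n - 1)"
    using n by (simp add: cJ sJ of_nat_diff)
qed

text \<open>Enlarging the sum of the other values to \<open>n\<^sup>2\<close> costs strictness only.
  Their mean becomes \<open>n * (n / (n - 1))\<close>, and the power \<open>n - 1\<close> of the
  second factor is at most Euler's number.\<close>

lemma lower_bound:
  assumes "i \<in> I" shows "1 / (exp 1 * real n ^ (n - 1)) < l i"
proof -
  have n1: "real n - 1 > 0" using n by simp
  have "(((real n)\<^sup>2 - l i) / (real n - 1)) ^ (n - 1) < ((real n)\<^sup>2 / (real n - 1)) ^ (n - 1)"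
    using others(1)[OF assms] pos[OF assms] n n1
    by (intro power_strict_mono divide_strict_right_mono) auto
  also have "\<dots> = real n ^ (n - 1) * (real n / (real n - 1)) ^ (n - 1)"
    by (simp add: power2_eq_square flip: power_mult_distrib)
  also have "\<dots> \<le> real n ^ (n - 1) * exp 1"
    using one_plus_inverse_power_le_exp[of "n - 1"] n
    by (intro mult_left_mono) (auto simp: of_nat_diff)
  finally have "1 < l i * (exp 1 * real n ^ (n - 1))"
    using others(2)[OF assms] mult_strict_left_mono[OF _ pos[OF assms]]
    by (smt (verit) mult.commute)
  then show ?thesis using n by (simp add: divide_less_eq)
qed

text \<open>Were \<open>l i\<close> this close to \<open>n\<^sup>2\<close>, the others would have
  mean at most 1/4, and the whole product would stay below
  \<open>n\<^sup>2 / 4 ^ (n - 1) \<le> 1\<close>.\<close>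

lemma upper_bound:
  assumes "i \<in> I" shows "l i < (real n)\<^sup>2 - (real n - 1) / 4"
proof (rule ccontr)
  assume "\<not> ?thesis"
  then have le: "((real n)\<^sup>2 - l i) / (real n - 1) \<le> 1 / 4" using n by (simp add: field_simps)
  have "1 \<le> l i * (((real n)\<^sup>2 - l i) / (real n - 1)) ^ (n - 1)" by (rule others(2)[OF assms])
  also have "\<dots> \<le> l i * (1 / 4) ^ (n - 1)"
    using le others(1)[OF assms] pos[OF assms] n by (intro mult_left_mono power_mono) auto
  also have "\<dots> < (real n)\<^sup>2 * (1 / 4) ^ (n - 1)"
    using others(1)[OF assms] by (intro mult_strict_right_mono) auto
  also have "\<dots> \<le> 1" using square_le_four_power[of n] n by (simp add: field_simps)
  finally show False by simp
qed

text \<open>Halving \<open>l j\<close> into two equal factors and dropping \<open>l i\<close> gives \<open>n\<close> numbers with sum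
  below \<open>n\<^sup>2\<close> and product \<open>(l j)\<^sup>2 * (\<Prod>k\<noteq>i,j. l k) / 4 \<ge> l j / (4 * l i)\<close>.\<close>

lemma ratio_bound:
  assumes "i \<in> I" "j \<in> I" shows "l j / l i < 4 * real n ^ n"
proof (cases "i = j")
  case True
  have "1 \<le> real n ^ n" using n by simp
  then show ?thesis using True pos[OF assms(1)] by simp
next
  case False
  define x where "x = l(i := l j / 2, j := l j / 2)"
  let ?K = "I - {i, j}"
  have I: "I = insert i (insert j ?K)" using assms by auto
  have xK: "sum x ?K = sum l ?K" "prod x ?K = prod l ?K"
    by (auto simp: x_def intro!: sum.cong prod.cong)
  have px: "x k > 0" if "k \<in> I" for k using pos[OF that] pos[OF assms(2)] by (simp add: x_def)
  have sl: "sum l I = l i + l j + sum l ?K" using False fin by (subst I) simp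
  have pl: "prod l I = l i * l j * prod l ?K" using False fin by (subst I) simp
  have sx: "sum x I = l j + sum l ?K" using False fin xK by (subst I) (simp add: x_def)
  have pX: "prod x I = (l j)\<^sup>2 / 4 * prod l ?K"
    using False fin xK by (subst I) (simp add: x_def power2_eq_square)
  have li: "l i > 0" and lj: "l j > 0" using pos assms by auto
  have "l j / l i \<le> l j / l i * prod l I" using prod li lj by (simp add: field_simps)
  also have "\<dots> = 4 * prod x I" using pl pX li by (simp add: power2_eq_square)
  also have "\<dots> \<le> 4 * (sum x I / real n) ^ n"
    using prod_le_mean_power[of I x] fin px card assms by auto
  \<comment> \<open>Strict because the discarded \<open>l i\<close> is positive: the new numbers
    have mean below \<open>n\<close>.\<close>
  also have "\<dots> < 4 * ((real n)\<^sup>2 / real n) ^ n"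
  proof -
    have "sum x I < (real n)\<^sup>2" using sl sx sum li by simp
    moreover have "0 \<le> sum x I" using px by (intro sum_nonneg) (auto intro: less_imp_le)
    ultimately show ?thesis using n
      by (intro mult_strict_left_mono power_strict_mono divide_strict_right_mono) auto
  qed
  also have "\<dots> = 4 * real n ^ n" by (simp add: power2_eq_square)
  finally show ?thesis .
qed

end

section \<open>The bounds\<close>

text \<open>\<open>Min\<close> is an element of its set only for finite nonempty sets; the list of
  Gram eigenvalues supplies both properties.\<close>

lemma sigma_min_square_eigenvalue:
  assumes A: "A \<in> carrier_mat n n" and n: "n > 0"
  shows "eigenvalue (mat_adjoint A * A) (complex_of_real ((sigma_min A)\<^sup>2))"
proof -
  obtain l where l: "\<And>i. i < n \<Longrightarrow> 0 \<le> l i"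
    "\<And>k. eigenvalue (mat_adjoint A * A) k \<longleftrightarrow> (\<exists>i<n. k = complex_of_real (l i))"
    using gram_eigenvalues[OF A] by metis
  have "singular_values A \<subseteq> (\<lambda>i. sqrt (l i)) ` {..<n}"
  proof
    fix s assume s: "s \<in> singular_values A"
    then obtain i where i: "i < n" "complex_of_real (s\<^sup>2) = complex_of_real (l i)"
      using l(2) by (auto simp: singular_values_def simp del: of_real_power)
    then have "s = sqrt (l i)" using s by (simp add: singular_values_def real_sqrt_unique del: of_real_power)
    then show "s \<in> (\<lambda>i. sqrt (l i)) ` {..<n}" using i by blast
  qed
  then have "finite (singular_values A)" by (rule finite_subset) simp
  moreover have "sqrt (l 0) \<in> singular_values A"
    using l n by (auto simp: singular_values_def simp del: of_real_power)
  ultimately have "sigma_min A \<in> singular_values A" unfolding sigma_min_def by (intro Min_in) auto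
  then show ?thesis by (simp add: singular_values_def)
qed

lemma finite_char_subsets:
  assumes "comm_group G" "finite (carrier G)"
  shows "finite (char_subsets G E)"
  using comm_group.finite_characters[OF assms]
  by (auto intro: finite_subset[of _ "Pow (characters G)"] simp: char_subsets_def)

text \<open>\<open>L_at\<close> and \<open>U_at\<close> are both members of the list
  \<open>l\<close>, so the bounds of \<open>spectrum\<close> apply at their indices. Positivity of
  the list also excludes the infinite value of \<open>rho_at\<close>.\<close>

lemma char_subset_bounds:
  fixes G (structure)
  assumes G: "comm_group G" "finite (carrier G)" and E: "E \<subseteq> carrier G" "card E = n" "n > 1"
    and B: "B \<in> char_subsets G E" and det: "1 \<le> D_at E B"
  shows "1 / (exp 1 * real n ^ (n - 1)) < L_at E B"
    and "U_at E B < (real n)\<^sup>2 - (real n - 1) / 4"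
    and "rho_at E B < ereal (4 * real n ^ n)"
proof -
  interpret comm_group G by fact
  let ?T = "T E B"
  have cB: "card B = n" "B \<subseteq> characters G" using B E by (auto simp: char_subsets_def)
  \<comment> \<open>Infinite sets have cardinality 0, whereas both cardinalities equal
    \<open>n > 1\<close>.\<close>
  have finE: "finite E" and finB: "finite B" using E cB by (auto intro: card_ge_0_finite)
  have TA: "?T \<in> carrier_mat n n" using E cB by (simp add: T_def)
  have unit: "cmod (?T $$ (i, j)) = 1" if "i < n" "j < n" for i j
  proof -
    have "enum_list E ! i \<in> E" "enum_list B ! j \<in> B"
      using that enum_list[OF finE] enum_list[OF finB] E cB by (metis nth_mem)+
    then have "cmod ((enum_list B ! j) (enum_list E ! i)) = 1"
      using E(1) cB(2) by (intro characters_norm[of _ G]) auto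
    then show ?thesis using that E(2) cB(1) by (simp add: T_def)
  qed
  obtain l where l: "\<And>i. i < n \<Longrightarrow> 0 \<le> l i"
    "\<And>k. eigenvalue (mat_adjoint ?T * ?T) k \<longleftrightarrow> (\<exists>i<n. k = complex_of_real (l i))"
    "(\<Sum>i<n. l i) = (\<Sum>i<n. \<Sum>j<n. (cmod (?T $$ (j, i)))\<^sup>2)"
    "(\<Prod>i<n. l i) = (cmod (det ?T))\<^sup>2"
    using gram_eigenvalues[OF TA] by blast
  have prod: "1 \<le> (\<Prod>i<n. l i)" using det unfolding l(4) D_at_def by (simp add: one_le_power)
  have "l i \<noteq> 0" if "i < n" for i
  proof
    assume "l i = 0"
    then have "(\<Prod>i<n. l i) = 0" using that by (intro prod_zero) auto
    then show False using prod by linarith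
  qed
  then have pos: "0 < l i" if "i < n" for i using l(1)[OF that] that by (simp add: less_le)
  have sum: "(\<Sum>i<n. l i) = (real n)\<^sup>2" unfolding l(3) by (simp add: unit power2_eq_square)
  interpret spectrum "{..<n}" l n
    using E(3) pos sum prod by unfold_locales auto
  obtain i where i: "i < n" "L_at E B = l i"
    using sigma_min_square_eigenvalue[OF TA] E(3) unfolding l(2) L_at_def of_real_eq_iff by auto
  obtain j where j: "j < n" "U_at E B = l j"
    using op_norm2_square_eigenvalue[OF TA] E(3) unfolding l(2) U_at_def of_real_eq_iff by auto
  show "1 / (exp 1 * real n ^ (n - 1)) < L_at E B" using lower_bound[of i] i by simp
  show "U_at E B < (real n)\<^sup>2 - (real n - 1) / 4" using upper_bound[of j] j by simp
  show "rho_at E B < ereal (4 * real n ^ n)"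
    using ratio_bound[of i j] pos[of i] i j by (simp add: rho_at_def)
qed

theorem theorem5p12:
  fixes G :: "('a, 'm) monoid_scheme" and E :: "'a set" and n :: nat
  assumes "comm_group G" and "finite (carrier G)"
    and "E \<subseteq> carrier G" and "card E = n" and "n > 1"
  shows "L_opt G E > 1 / (exp 1 * real n ^ (n - 1))
    \<and> U_opt G E < (real n)\<^sup>2 - (real n - 1) / 4
    \<and> rho_opt G E < ereal (4 * real n ^ n)
    \<and> D_opt G E \<ge> 1"
proof -
  obtain B where B: "B \<in> char_subsets G E" "1 \<le> D_at E B"
    using exists_char_subset_det_ge_1[OF assms(1-3)] by blast
  note bounds = char_subset_bounds[OF assms B]
  have fin: "finite (f ` char_subsets G E)" for f :: "('a \<Rightarrow> complex) set \<Rightarrow> 'x"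
    using finite_char_subsets[OF assms(1,2)] by (rule finite_imageI)
  \<comment> \<open>Finiteness of the index set is what lets the value at \<open>B\<close> be
    compared with \<open>Max\<close> and \<open>Min\<close>.\<close>
  have "L_at E B \<le> L_opt G E" "D_at E B \<le> D_opt G E"
    unfolding L_opt_def D_opt_def using B(1) fin by (auto intro: Max_ge)
  moreover have "U_opt G E \<le> U_at E B" "rho_opt G E \<le> rho_at E B"
    unfolding U_opt_def rho_opt_def using B(1) fin by (auto intro: Min_le)
  ultimately show ?thesis using bounds B(2) by (meson order.strict_trans1 order.strict_trans2 order.trans)
qed

end
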